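(* Let $M$ be a positive integer congruent to $1$ or $4$ modulo $5$. Let $N>M$ be an integer not congruent to $1$ or $4$ modulo $5$, and let $n\ge1$. The number of partitions of $n$ all of whose parts are either congruent to $1$ or $4$ modulo $5$ and different from $M$, or equal to $N$, is equal to the number of partitions $\lambda=(\lambda_1\ge\lambda_2\ge\cdots)$ of $n$ with difference at least $2$ such that either (1) $\lambda$ has a single part, which is congruent to $0,1,\ldots,$ or $M-1$ modulo $N$; or (2) $\lambda$ has at least two parts, and $\lambda_1-\lambda_2-2$ is congruent to $0,1,\ldots,$ or $M-1$ modulo $N$.
   Context: A partition $\lambda=(\lambda_1\ge\lambda_2\ge\cdots\ge\lambda_\ell\ge 1)$ has "difference at least $2$" if $\lambda_i-\lambda_{i+1}\ge 2$ for all $1\le i<\ell$ (a one-part partition satisfies this vacuously). *)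

theory Defs
  imports Main "HOL-Number_Theory.Cong"
begin

text \<open>Partitions are lists of positive parts in weakly decreasing order, so that the largest part
  is \<open>l ! 0\<close> and the second largest (with multiplicity) is \<open>l ! 1\<close>.\<close>

definition is_partition :: "nat \<Rightarrow> nat list \<Rightarrow> bool" where
  "is_partition n l \<longleftrightarrow> sorted_wrt (\<ge>) l \<and> (\<forall>p\<in>set l. p \<ge> 1) \<and> sum_list l = n"

definition difference_at_least_2 :: "nat list \<Rightarrow> bool" where
  "difference_at_least_2 l \<longleftrightarrow> (\<forall>i. Suc i < length l \<longrightarrow> int (l ! i) - int (l ! Suc i) \<ge> 2)"

text \<open>Ensures that \<open>card\<close> genuinely counts, since it is \<open>0\<close> on infinite sets. Partitions of \<open>n\<close> form a finite set.\<close>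

lemma finite_partitions: "finite {l. is_partition n l}"
proof (rule finite_subset)
  show "{l. is_partition n l} \<subseteq> {l. set l \<subseteq> {..n} \<and> length l \<le> n}"
  proof (intro subsetI CollectI)
    fix l assume "l \<in> {l. is_partition n l}"
    then have pos: "\<forall>p\<in>set l. p \<ge> 1" and s: "sum_list l = n"
      by (auto simp: is_partition_def)
    have "length l \<le> sum_list l" using pos by (induction l) auto
    moreover have "set l \<subseteq> {..n}" using member_le_sum_list s by auto
    ultimately show "set l \<subseteq> {..n} \<and> length l \<le> n" using s by simp
  qed
  show "finite {l. set l \<subseteq> {..n} \<and> length l \<le> n}"
    by (rule finite_lists_length_le) simp
qed

end

theory Submission
  imports Defs "HOL-Computational_Algebra.Formal_Power_Series"
begin

text \<open>Let \<open>R\<close> be the generating function of the partitions with difference at least \<open>2\<close>, and \<open>A S\<close>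
  that of the partitions with all parts in \<open>S\<close>. Both sides of the claimed identity are one factor
  away from these series.

  Deleting \<open>s\<close> from the set of allowed parts multiplies \<open>A S\<close> by \<open>1 - X ^ s\<close>. Hence the series on
  the left, \<open>L\<close>, satisfies \<open>(1 - X ^ N) * L = (1 - X ^ M) * A S\<close>, where \<open>S\<close> consists of the
  numbers congruent to \<open>1\<close> or \<open>4\<close> modulo \<open>5\<close> (\<open>parts_gf_exchange\<close>).

  Call \<open>\<lambda>1 - \<lambda>2 - 2\<close>, or \<open>\<lambda>1\<close> if there is a single part, the slack of a partition with difference
  at least \<open>2\<close>; it is the amount by which the largest part may be lowered. Adding \<open>s\<close> to the largest part is a bijection onto the
  partitions with slack at least \<open>s\<close>. With \<open>s = M\<close> it shows that slack below \<open>M\<close> is counted by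
  \<open>(1 - X ^ M) * R\<close>; with \<open>s = N\<close>, it reduces a slack with residue below \<open>M\<close> modulo \<open>N\<close> to a
  slack below \<open>M\<close>. So the series \<open>B\<close> on the right satisfies
  \<open>(1 - X ^ N) * B = (1 - X ^ M) * R\<close> (\<open>slack_gf_mod\<close>).

  What remains is \<open>R = A S\<close>, the first Rogers--Ramanujan identity. It is proved by Schur's finite
  form: splitting off the largest part gives a three-term recurrence for the polynomials that count
  partitions with difference at least \<open>2\<close> and bounded parts, and an alternating sum of
  \<open>q\<close>-binomial coefficients satisfies the same recurrence (\<open>schur_even_Suc\<close>, \<open>schur_odd_Suc\<close>). Each
  \<open>q\<close>-binomial coefficient in that sum agrees to high order with \<open>1 / ((1 - q) (1 - q^2) \<dots>)\<close>, so
  the sum becomes a theta series divided by this product. The finite Jacobi triple product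
  (\<open>finite_triple_product\<close>) turns the theta series into the product of all \<open>1 - q ^ j\<close> with \<open>j\<close>
  congruent to \<open>0\<close>, \<open>2\<close> or \<open>3\<close> modulo \<open>5\<close>, and the quotient is the product for \<open>A S\<close>.

  Infinite products and limits do not occur: for each \<open>n\<close> all series are compared modulo
  \<open>X ^ (n + 1)\<close> with sufficiently long finite products.\<close>

section \<open>Gaussian binomial coefficients\<close>

text \<open>The lower index is an integer, so that the coefficient vanishes outside \<open>{0..n}\<close> and sums over
  it can be shifted without boundary terms.\<close>

primrec qbinom :: "'a::comm_ring_1 \<Rightarrow> nat \<Rightarrow> int \<Rightarrow> 'a" where
  "qbinom q 0 r = (if r = 0 then 1 else 0)"
| "qbinom q (Suc n) r = qbinom q n (r - 1) + q ^ nat r * qbinom q n r"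

lemma qbinom_eq_0: "r < 0 \<or> r > int n \<Longrightarrow> qbinom q n r = 0"
  by (induction n arbitrary: r) auto

text \<open>Exponents are integers truncated by \<open>nat\<close>, which respects addition only on nonnegative numbers. As
  the coefficient vanishes outside its range, an identity between the powers in front of it need
  only be checked where the exponents are genuine.\<close>

lemma qbinom_mult_cong:
  assumes "0 \<le> r \<Longrightarrow> r \<le> int n \<Longrightarrow> x = y"
  shows "x * qbinom q n r = y * qbinom q n r"
  using assms qbinom_eq_0[of r n q] by (cases "0 \<le> r \<and> r \<le> int n") auto

text \<open>The second Pascal rule, the mirror image of the defining one under \<open>r \<mapsto> n - r\<close>. Expanding
  both terms of the recursion by the induction hypothesis and regrouping gives it for the next
  \<open>n\<close>.\<close>

lemma qbinom_Suc':
  "qbinom q (Suc n) r = qbinom q n r + q ^ nat (int n + 1 - r) * qbinom q n (r - 1)"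
proof (induction n arbitrary: r)
  case 0
  then show ?case by auto
next
  case (Suc n)
  have *: "q ^ nat r * q ^ nat (int n + 1 - r) * qbinom q n (r - 1)
      = q ^ nat (int n + 2 - r) * q ^ nat (r - 1) * qbinom q n (r - 1)"
    by (rule qbinom_mult_cong) (simp flip: power_add nat_add_distrib)
  have "qbinom q (Suc (Suc n)) r = qbinom q (Suc n) (r - 1) + q ^ nat r * qbinom q (Suc n) r"
    by simp
  also have "\<dots> = (qbinom q n (r - 1) + q ^ nat (int n + 2 - r) * qbinom q n (r - 2))
      + q ^ nat r * (qbinom q n r + q ^ nat (int n + 1 - r) * qbinom q n (r - 1))"
    using Suc.IH[of "r - 1"] Suc.IH[of r] by (simp add: algebra_simps del: qbinom.simps)
  also have "\<dots> = (qbinom q n (r - 1) + q ^ nat r * qbinom q n r)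
      + q ^ nat (int n + 2 - r) * (qbinom q n (r - 2) + q ^ nat (r - 1) * qbinom q n (r - 1))"
    using * by (simp add: algebra_simps)
  also have "\<dots> = qbinom q (Suc n) r + q ^ nat (int (Suc n) + 1 - r) * qbinom q (Suc n) (r - 1)"
    by (simp add: algebra_simps)
  finally show ?case .
qed

definition qfact :: "'a::comm_ring_1 \<Rightarrow> nat \<Rightarrow> 'a" where
  "qfact q n = (\<Prod>j=1..n. 1 - q ^ j)"

lemma qfact_0 [simp]: "qfact q 0 = 1"
  by (simp add: qfact_def)

lemma qfact_Suc: "qfact q (Suc n) = qfact q n * (1 - q ^ Suc n)"
  by (simp add: qfact_def)

lemma qfact_mult_qbinom:
  "k \<le> n \<Longrightarrow> qfact q k * qfact q (n - k) * qbinom q n (int k) = qfact q n"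
proof (induction n arbitrary: k)
  case 0
  then show ?case by simp
next
  case (Suc n)
  consider "k = 0" | "k = Suc n" | j where "k = Suc j" "j < n"
    using Suc.prems by (cases k) fastforce+
  then show ?case
  proof cases
    case 1
    then show ?thesis
      using arg_cong[OF Suc.IH[of 0], of "\<lambda>x. x * (1 - q ^ Suc n)"]
      by (simp add: qbinom_eq_0 qfact_Suc mult_ac)
  next
    case 2
    have "qbinom q n (1 + int n) = 0" by (rule qbinom_eq_0) simp
    then show ?thesis
      using 2 arg_cong[OF Suc.IH[of n], of "\<lambda>x. x * (1 - q ^ Suc n)"]
      by (simp add: qfact_Suc mult_ac)
  next
    case 3
    define d where "d = n - Suc j"
    have n: "n = Suc j + d" using 3 by (simp add: d_def)
    have IH1: "qfact q j * qfact q (Suc d) * qbinom q n (int j) = qfact q n"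
      using Suc.IH[of j] n by (simp add: Suc_diff_le)
    have IH2: "qfact q (Suc j) * qfact q d * qbinom q n (int (Suc j)) = qfact q n"
      using Suc.IH[of "Suc j"] n by simp
    have "qbinom q (Suc n) (int (Suc j)) = qbinom q n (int j) + q ^ Suc j * qbinom q n (int (Suc j))"
      using qbinom.simps(2)[of q n "int (Suc j)"] by (simp only: nat_int) simp
    then have "qfact q k * qfact q (Suc n - k) * qbinom q (Suc n) (int k)
        = qfact q (Suc j) * qfact q (Suc d)
            * (qbinom q n (int j) + q ^ Suc j * qbinom q n (int (Suc j)))"
      using 3 n by (simp del: qbinom.simps power_Suc of_nat_Suc)
    also have "\<dots> = (1 - q ^ Suc j) * (qfact q j * qfact q (Suc d) * qbinom q n (int j))
        + q ^ Suc j * (1 - q ^ Suc d) * (qfact q (Suc j) * qfact q d * qbinom q n (int (Suc j)))"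
      by (simp add: qfact_Suc algebra_simps del: power_Suc)
    also have "\<dots> = (1 - q ^ (Suc j + Suc d)) * qfact q n"
      by (simp only: IH1 IH2 power_add) (simp add: algebra_simps)
    also have "\<dots> = qfact q (Suc n)"
      by (simp add: qfact_Suc n mult_ac)
    finally show ?thesis .
  qed
qed

lemma sum_shift_int:
  fixes f :: "int \<Rightarrow> 'a::comm_monoid_add"
  assumes "\<And>i. \<bar>i\<bar> \<ge> K \<Longrightarrow> f i = 0"
  shows "(\<Sum>i=-K..K. f (i + 1)) = (\<Sum>i=-K..K. f i)"
proof -
  have "(\<Sum>i=-K..K. f (i + 1)) = (\<Sum>i=-K+1..K+1. f i)"
    by (rule sum.reindex_bij_witness[of _ "\<lambda>i. i - 1" "\<lambda>i. i + 1"]) auto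
  also have "\<dots> = (\<Sum>i=-K..K+1. f i)"
    by (rule sum.mono_neutral_left) (auto intro!: assms)
  also have "\<dots> = (\<Sum>i=-K..K. f i)"
    by (rule sum.mono_neutral_right) (auto intro!: assms)
  finally show ?thesis .
qed

section \<open>Schur's recurrence\<close>

text \<open>Schur's alternating sum is \<open>\<Sum>k. (-1)^k q^(k(5k+1)/2) [n, \<lfloor>(n - 5k)/2\<rfloor>]\<close>. The floor depends on the
  parities of \<open>n\<close> and \<open>k\<close>; the cases \<open>n = 2 m\<close> and \<open>n = 2 m + 1\<close> are separate definitions, and in
  each of them the terms \<open>k = 2 i\<close> and \<open>k = 2 i + 1\<close> are paired. The bound \<open>K\<close> is any number large
  enough to cover all nonzero terms.\<close>

definition schur_even :: "'a::comm_ring_1 \<Rightarrow> int \<Rightarrow> nat \<Rightarrow> 'a" where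
  "schur_even q K m = (\<Sum>i=-K..K.
     q ^ nat (i * (10 * i + 1)) * qbinom q (2 * m) (int m - 5 * i)
   - q ^ nat ((2 * i + 1) * (5 * i + 3)) * qbinom q (2 * m) (int m - 5 * i - 3))"

definition schur_odd :: "'a::comm_ring_1 \<Rightarrow> int \<Rightarrow> nat \<Rightarrow> 'a" where
  "schur_odd q K m = (\<Sum>i=-K..K.
     q ^ nat (i * (10 * i + 1)) * qbinom q (2 * m + 1) (int m - 5 * i)
   - q ^ nat ((2 * i + 1) * (5 * i + 3)) * qbinom q (2 * m + 1) (int m - 5 * i - 2))"

lemma exponent_nonneg:
  fixes i :: int
  shows "i * (10 * i + 1) \<ge> 0" and "(2 * i + 1) * (5 * i + 3) \<ge> 0"
proof -
  have "i \<ge> 0 \<or> i \<le> -1" by linarith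
  then show "i * (10 * i + 1) \<ge> 0" and "(2 * i + 1) * (5 * i + 3) \<ge> 0"
    by (auto simp: zero_le_mult_iff)
qed

lemma pow_nat_mult_pow_nat:
  fixes q :: "'a::comm_ring_1"
  shows "x \<ge> 0 \<Longrightarrow> y \<ge> 0 \<Longrightarrow> q ^ nat x * q ^ nat y = q ^ nat (x + y)"
  by (simp only: nat_add_distrib power_add)

text \<open>One Pascal rule is applied to the even terms and the other one to the odd terms, so that each
  produces the corresponding term with upper index \<open>2 m + 1\<close>; applying the opposite rule to the
  remainder produces the term with upper index \<open>2 m\<close>. The even terms leave a surplus \<open>u i\<close>, the odd
  terms a surplus \<open>v i = u (i + 1)\<close> of opposite sign, and these telescope.\<close>

lemma schur_even_Suc:
  fixes q :: "'a::comm_ring_1"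
  assumes "K > int m + 1"
  shows "schur_even q K (Suc m) = schur_odd q K m + q ^ (2 * m + 1) * schur_even q K m"
proof -
  define u where "u i = q ^ nat (i * (10 * i + 1)) * q ^ nat (int m + 1 - 5 * i)
                        * qbinom q (2 * m) (int m + 1 - 5 * i)" for i
  have u0: "u i = 0" if "\<bar>i\<bar> \<ge> K" for i
    unfolding u_def by (subst qbinom_eq_0) (use that assms in auto)
  have E: "qbinom q (2 * Suc m) (int (Suc m) - 5 * i)
      = qbinom q (2 * m + 1) (int m - 5 * i)
        + q ^ nat (int m + 1 - 5 * i) * qbinom q (2 * m) (int m + 1 - 5 * i)
        + q ^ (2 * m + 1) * qbinom q (2 * m) (int m - 5 * i)" for i
  proof -
    have "q ^ nat (int m + 1 - 5 * i) * q ^ nat (int m + 5 * i) * qbinom q (2 * m) (int m - 5 * i)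
        = q ^ (2 * m + 1) * qbinom q (2 * m) (int m - 5 * i)"
      by (rule qbinom_mult_cong) (simp add: pow_nat_mult_pow_nat nat_add_distrib nat_mult_distrib)
    moreover have "qbinom q (2 * Suc m) (int (Suc m) - 5 * i)
      = qbinom q (2 * m + 1) (int m - 5 * i)
        + q ^ nat (int m + 1 - 5 * i) * qbinom q (Suc (2 * m)) (int m + 1 - 5 * i)"
      by (simp add: algebra_simps)
    moreover have "qbinom q (Suc (2 * m)) (int m + 1 - 5 * i)
       = qbinom q (2 * m) (int m + 1 - 5 * i)
         + q ^ nat (int m + 5 * i) * qbinom q (2 * m) (int m - 5 * i)"
      by (subst qbinom_Suc') (simp add: algebra_simps)
    ultimately show ?thesis by (simp add: algebra_simps)
  qed
  have O: "qbinom q (2 * Suc m) (int (Suc m) - 5 * i - 3)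
      = qbinom q (2 * m + 1) (int m - 5 * i - 2)
        + q ^ nat (int m + 5 * i + 4) * qbinom q (2 * m) (int m - 5 * i - 4)
        + q ^ (2 * m + 1) * qbinom q (2 * m) (int m - 5 * i - 3)" for i
  proof -
    have "q ^ nat (int m + 5 * i + 4) * q ^ nat (int m - 5 * i - 3)
          * qbinom q (2 * m) (int m - 5 * i - 3)
        = q ^ (2 * m + 1) * qbinom q (2 * m) (int m - 5 * i - 3)"
      by (rule qbinom_mult_cong) (simp add: pow_nat_mult_pow_nat nat_add_distrib nat_mult_distrib)
    moreover have "qbinom q (Suc (2 * m + 1)) (int m - 5 * i - 2)
      = qbinom q (2 * m + 1) (int m - 5 * i - 2)
        + q ^ nat (int m + 5 * i + 4) * qbinom q (2 * m + 1) (int m - 5 * i - 3)"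
      by (subst qbinom_Suc') (simp add: algebra_simps)
    moreover have "qbinom q (2 * m + 1) (int m - 5 * i - 3)
       = qbinom q (2 * m) (int m - 5 * i - 4)
         + q ^ nat (int m - 5 * i - 3) * qbinom q (2 * m) (int m - 5 * i - 3)"
      by (simp add: algebra_simps)
    ultimately show ?thesis by (simp add: algebra_simps del: qbinom.simps)
  qed
  \<comment> \<open>The surpluses of the even and of the odd terms, which cancel after a shift of \<open>i\<close>.\<close>
  define v where "v i = q ^ nat ((2 * i + 1) * (5 * i + 3)) * q ^ nat (int m + 5 * i + 4)
           * qbinom q (2 * m) (int m - 5 * i - 4)" for i
  have v: "v i = u (i + 1)" for i
  proof -
    have "u (i + 1) = q ^ nat ((i + 1) * (10 * (i + 1) + 1)) * q ^ nat (int m - 5 * i - 4)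
                        * qbinom q (2 * m) (int m - 5 * i - 4)"
      by (simp add: u_def algebra_simps)
    moreover have "q ^ nat ((2 * i + 1) * (5 * i + 3)) * q ^ nat (int m + 5 * i + 4)
           * qbinom q (2 * m) (int m - 5 * i - 4)
       = q ^ nat ((i + 1) * (10 * (i + 1) + 1)) * q ^ nat (int m - 5 * i - 4)
           * qbinom q (2 * m) (int m - 5 * i - 4)"
    proof (rule qbinom_mult_cong)
      assume "0 \<le> int m - 5 * i - 4" "int m - 5 * i - 4 \<le> int (2 * m)"
      then show "q ^ nat ((2 * i + 1) * (5 * i + 3)) * q ^ nat (int m + 5 * i + 4)
        = q ^ nat ((i + 1) * (10 * (i + 1) + 1)) * q ^ nat (int m - 5 * i - 4)"
        using exponent_nonneg(1)[of "i + 1"] exponent_nonneg(2)[of i]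
        by (simp add: pow_nat_mult_pow_nat del: of_nat_mult) (simp add: algebra_simps)
    qed
    ultimately show ?thesis by (simp add: v_def)
  qed
  have "schur_even q K (Suc m) = schur_odd q K m + q ^ (2 * m + 1) * schur_even q K m
          + ((\<Sum>i=-K..K. u i) - (\<Sum>i=-K..K. v i))"
    unfolding schur_even_def schur_odd_def sum_distrib_left sum.distrib[symmetric]
      sum_subtractf[symmetric] E O u_def v_def
    by (intro sum.cong refl) (simp add: algebra_simps del: qbinom.simps)
  then show ?thesis using sum_shift_int[of K u] u0 by (simp add: v)
qed

text \<open>As above, but here the surpluses of the two terms with the same \<open>i\<close> cancel directly.\<close>

lemma schur_odd_Suc:
  fixes q :: "'a::comm_ring_1"
  shows "schur_odd q K (Suc m) = schur_even q K (Suc m) + q ^ (2 * m + 2) * schur_odd q K m"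
proof -
  have E: "qbinom q (2 * Suc m + 1) (int (Suc m) - 5 * i)
      = qbinom q (2 * Suc m) (int (Suc m) - 5 * i)
        + q ^ nat (int m + 2 + 5 * i) * qbinom q (2 * m + 1) (int m - 5 * i - 1)
        + q ^ (2 * m + 2) * qbinom q (2 * m + 1) (int m - 5 * i)" for i
  proof -
    have "q ^ nat (int m + 2 + 5 * i) * q ^ nat (int m - 5 * i)
          * qbinom q (2 * m + 1) (int m - 5 * i)
        = q ^ (2 * m + 2) * qbinom q (2 * m + 1) (int m - 5 * i)"
      by (rule qbinom_mult_cong) (simp add: pow_nat_mult_pow_nat nat_add_distrib nat_mult_distrib)
    moreover have "qbinom q (Suc (2 * Suc m)) (int (Suc m) - 5 * i)
      = qbinom q (2 * Suc m) (int (Suc m) - 5 * i)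
        + q ^ nat (int m + 2 + 5 * i) * qbinom q (Suc (2 * m + 1)) (int m - 5 * i)"
      by (subst qbinom_Suc') (simp add: algebra_simps)
    moreover have "qbinom q (Suc (2 * m + 1)) (int m - 5 * i)
       = qbinom q (2 * m + 1) (int m - 5 * i - 1)
         + q ^ nat (int m - 5 * i) * qbinom q (2 * m + 1) (int m - 5 * i)"
      by simp
    ultimately show ?thesis by (simp add: algebra_simps del: qbinom.simps)
  qed
  have O: "qbinom q (2 * Suc m + 1) (int (Suc m) - 5 * i - 2)
      = qbinom q (2 * Suc m) (int (Suc m) - 5 * i - 3)
        + q ^ nat (int m - 5 * i - 1) * qbinom q (2 * m + 1) (int m - 5 * i - 1)
        + q ^ (2 * m + 2) * qbinom q (2 * m + 1) (int m - 5 * i - 2)" for i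
  proof -
    have "q ^ nat (int m - 5 * i - 1) * q ^ nat (int m + 5 * i + 3)
          * qbinom q (2 * m + 1) (int m - 5 * i - 2)
        = q ^ (2 * m + 2) * qbinom q (2 * m + 1) (int m - 5 * i - 2)"
      by (rule qbinom_mult_cong) (simp add: pow_nat_mult_pow_nat nat_add_distrib nat_mult_distrib)
    moreover have "qbinom q (Suc (2 * Suc m)) (int (Suc m) - 5 * i - 2)
      = qbinom q (2 * Suc m) (int (Suc m) - 5 * i - 3)
        + q ^ nat (int m - 5 * i - 1) * qbinom q (Suc (2 * m + 1)) (int m - 5 * i - 1)"
      by (subst qbinom.simps) (simp add: algebra_simps)
    moreover have "qbinom q (Suc (2 * m + 1)) (int m - 5 * i - 1)
       = qbinom q (2 * m + 1) (int m - 5 * i - 1)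
         + q ^ nat (int m + 5 * i + 3) * qbinom q (2 * m + 1) (int m - 5 * i - 2)"
      by (subst qbinom_Suc') (simp add: algebra_simps)
    ultimately show ?thesis by (simp add: algebra_simps del: qbinom.simps)
  qed
  have u1: "q ^ nat ((2 * i + 1) * (5 * i + 3)) * q ^ nat (int m - 5 * i - 1)
           * qbinom q (2 * m + 1) (int m - 5 * i - 1)
         = q ^ nat (i * (10 * i + 1)) * q ^ nat (int m + 2 + 5 * i)
           * qbinom q (2 * m + 1) (int m - 5 * i - 1)" for i
  proof (rule qbinom_mult_cong)
    assume "0 \<le> int m - 5 * i - 1" "int m - 5 * i - 1 \<le> int (2 * m + 1)"
    then show "q ^ nat ((2 * i + 1) * (5 * i + 3)) * q ^ nat (int m - 5 * i - 1)
        = q ^ nat (i * (10 * i + 1)) * q ^ nat (int m + 2 + 5 * i)"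
      using exponent_nonneg[of i]
      by (simp add: pow_nat_mult_pow_nat) (simp add: algebra_simps)
  qed
  show ?thesis
    unfolding schur_even_def schur_odd_def sum_distrib_left sum.distrib[symmetric] E O
    by (intro sum.cong refl, insert u1) (simp add: algebra_simps del: qbinom.simps)
qed

lemma schur_0:
  fixes q :: "'a::comm_ring_1"
  assumes "K \<ge> 0"
  shows "schur_even q K 0 = 1" and "schur_odd q K 0 = 1"
proof -
  have [simp]: "- (5 * i) - c \<noteq> 0" if "c \<in> {1, 2, 3}" for i c :: int
    using that by (elim insertE emptyE; simp; presburger)
  have delta: "(\<Sum>i=-K..K. if i = 0 then 1 else (0::'a)) = 1"
    using assms by simp
  have "schur_even q K 0 = (\<Sum>i=-K..K. if i = 0 then 1 else (0::'a))"
    unfolding schur_even_def by (intro sum.cong refl) simp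
  then show "schur_even q K 0 = 1" using delta by simp
  have "schur_odd q K 0 = (\<Sum>i=-K..K. if i = 0 then 1 else (0::'a))"
    unfolding schur_odd_def by (intro sum.cong refl) simp
  then show "schur_odd q K 0 = 1" using delta by simp
qed

section \<open>The finite Jacobi triple product\<close>

definition triangle :: "int \<Rightarrow> nat" where
  "triangle k = nat (k * (k + 1) div 2)"

lemma int_triangle: "2 * int (triangle k) = k * (k + 1)"
proof -
  have "k \<ge> 0 \<or> k \<le> -1" by linarith
  then have "k * (k + 1) \<ge> 0" by (auto simp: zero_le_mult_iff)
  moreover have "even (k * (k + 1))" by simp
  ultimately show ?thesis unfolding triangle_def by (simp add: dvd_div_mult_self)
qed

lemma nat_eq_if_double_eq: "2 * int m = 2 * int n \<Longrightarrow> m = n"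
  by simp

text \<open>The general term of Ramanujan's theta function \<open>f (-a, -b)\<close>. In contrast to the form with terms
  \<open>x ^ k * q ^ (k * (k - 1) div 2)\<close>, no negative powers occur, so that it makes sense in every
  commutative ring.\<close>

definition theta_coeff :: "'a::comm_ring_1 \<Rightarrow> 'a \<Rightarrow> int \<Rightarrow> 'a" where
  "theta_coeff a b k = (if even k then 1 else -1) * a ^ triangle k * b ^ triangle (k - 1)"

text \<open>The neighbouring coefficients differ by powers of \<open>a * b\<close> and one factor \<open>a\<close> or \<open>b\<close>; the powers
  are exactly the ones that the Pascal rules produce.\<close>

lemma theta_coeff_neighbours:
  assumes "k \<le> int n" "- int n \<le> k"
  shows "(a * b) ^ nat (int n - k) * theta_coeff a b (k + 1) = - (a * (a * b) ^ n) * theta_coeff a b k"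
    and "(a * b) ^ nat (int n + k) * theta_coeff a b (k - 1) = - (b * (a * b) ^ n) * theta_coeff a b k"
proof -
  have 1: "nat (int n - k) + triangle (k + 1) = n + 1 + triangle k"
    using assms int_triangle[of "k + 1"] int_triangle[of k]
    by (intro nat_eq_if_double_eq) (simp add: algebra_simps)
  have 2: "nat (int n - k) + triangle k = n + triangle (k - 1)"
    using assms int_triangle[of "k - 1"] int_triangle[of k]
    by (intro nat_eq_if_double_eq) (simp add: algebra_simps)
  have "a ^ (nat (int n - k) + triangle (k + 1)) * b ^ (nat (int n - k) + triangle k)
     = a ^ (n + 1 + triangle k) * b ^ (n + triangle (k - 1))"
    by (simp only: 1 2)
  then show "(a * b) ^ nat (int n - k) * theta_coeff a b (k + 1)
      = - (a * (a * b) ^ n) * theta_coeff a b k"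
    by (simp add: theta_coeff_def power_add power_mult_distrib mult_ac)
  have 3: "nat (int n + k) + triangle (k - 1) = n + triangle k"
    using assms int_triangle[of "k - 1"] int_triangle[of k]
    by (intro nat_eq_if_double_eq) (simp add: algebra_simps)
  have 4: "nat (int n + k) + triangle (k - 2) = n + 1 + triangle (k - 1)"
    using assms int_triangle[of "k - 1"] int_triangle[of "k - 2"]
    by (intro nat_eq_if_double_eq) (simp add: algebra_simps)
  have "a ^ (nat (int n + k) + triangle (k - 1)) * b ^ (nat (int n + k) + triangle (k - 2))
     = a ^ (n + triangle k) * b ^ (n + 1 + triangle (k - 1))"
    by (simp only: 3 4)
  then show "(a * b) ^ nat (int n + k) * theta_coeff a b (k - 1)
      = - (b * (a * b) ^ n) * theta_coeff a b k"
    by (simp add: theta_coeff_def power_add power_mult_distrib mult_ac)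
qed

text \<open>In the induction step both Pascal rules write \<open>[2 n + 2, n + 1 + k]\<close> in terms of
  \<open>[2 n, n + k - 1]\<close>, \<open>[2 n, n + k]\<close> and \<open>[2 n, n + k + 1]\<close>. After a shift of \<open>k\<close> in the outer two
  sums the coefficients add up to \<open>1 + Q^(2n+1) - a Q^n - b Q^n\<close>, which is the product of the two
  new factors because \<open>Q = a * b\<close>.\<close>

lemma finite_triple_product:
  fixes a b :: "'a::comm_ring_1"
  assumes "K > int n"
  shows "(\<Prod>j<n. (1 - a * (a * b) ^ j) * (1 - b * (a * b) ^ j))
       = (\<Sum>k=-K..K. theta_coeff a b k * qbinom (a * b) (2 * n) (int n + k))"
  using assms
proof (induction n)
  case 0
  have "(\<Sum>k=-K..K. theta_coeff a b k * qbinom (a * b) (2 * 0) (int 0 + k))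
      = (\<Sum>k=-K..K. if k = 0 then 1 else (0::'a))"
    by (intro sum.cong refl) (auto simp: theta_coeff_def triangle_def)
  also have "\<dots> = 1" using 0 by (simp add: sum.delta)
  finally show ?case by simp
next
  case (Suc n)
  define Q where "Q = a * b"
  define c where "c k = theta_coeff a b k * qbinom Q (2 * n) (int n + k)" for k
  define f where "f k = - (a * Q ^ n) * c k" for k
  define g where "g k = - (b * Q ^ n) * c k" for k
  have c0: "c k = 0" if "\<bar>k\<bar> > int n" for k
    unfolding c_def by (subst qbinom_eq_0) (use that Suc.prems in auto)
  \<comment> \<open>The outer Pascal terms have become \<open>f (k - 1)\<close> and \<open>g (k + 1)\<close>: the powers of \<open>Q\<close> in front of
    them move the theta coefficient to the neighbouring index.\<close>
  have step: "theta_coeff a b k * qbinom Q (2 * Suc n) (int (Suc n) + k)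
      = (1 + Q ^ (2 * n + 1)) * c k + f (k - 1) + g (k + 1)" for k
  proof -
    have 1: "qbinom Q (Suc (2 * n + 1)) (int (Suc n) + k)
       = qbinom Q (Suc (2 * n)) (int n + k)
         + Q ^ nat (int n + 1 + k) * qbinom Q (Suc (2 * n)) (int n + k + 1)"
      by (subst qbinom.simps) (simp add: algebra_simps)
    have 2: "qbinom Q (Suc (2 * n)) (int n + k)
       = qbinom Q (2 * n) (int n + k)
         + Q ^ nat (int n + 1 - k) * qbinom Q (2 * n) (int n + k - 1)"
      by (subst qbinom_Suc') (simp add: algebra_simps)
    have 3: "qbinom Q (Suc (2 * n)) (int n + k + 1)
       = qbinom Q (2 * n) (int n + k + 1)
         + Q ^ nat (int n - k) * qbinom Q (2 * n) (int n + k)"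
      by (subst qbinom_Suc') (simp add: algebra_simps)
    have mid: "Q ^ nat (int n + 1 + k) * Q ^ nat (int n - k) * qbinom Q (2 * n) (int n + k)
      = Q ^ (2 * n + 1) * qbinom Q (2 * n) (int n + k)"
      by (rule qbinom_mult_cong) (simp add: pow_nat_mult_pow_nat nat_add_distrib nat_mult_distrib)
    have left: "(Q ^ nat (int n + 1 - k) * theta_coeff a b k) * qbinom Q (2 * n) (int n + k - 1)
        = (- (a * Q ^ n) * theta_coeff a b (k - 1)) * qbinom Q (2 * n) (int n + k - 1)"
      by (rule qbinom_mult_cong)
         (use theta_coeff_neighbours(1)[of "k - 1" n a b] in \<open>simp add: Q_def algebra_simps\<close>)
    have right: "(Q ^ nat (int n + 1 + k) * theta_coeff a b k) * qbinom Q (2 * n) (int n + k + 1)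
        = (- (b * Q ^ n) * theta_coeff a b (k + 1)) * qbinom Q (2 * n) (int n + k + 1)"
      by (rule qbinom_mult_cong)
         (use theta_coeff_neighbours(2)[of "k + 1" n a b] in \<open>simp add: Q_def algebra_simps\<close>)
    have "theta_coeff a b k * qbinom Q (2 * Suc n) (int (Suc n) + k)
       = theta_coeff a b k * qbinom Q (2 * n) (int n + k)
         + theta_coeff a b k
            * (Q ^ nat (int n + 1 + k) * Q ^ nat (int n - k) * qbinom Q (2 * n) (int n + k))
         + (Q ^ nat (int n + 1 - k) * theta_coeff a b k) * qbinom Q (2 * n) (int n + k - 1)
         + (Q ^ nat (int n + 1 + k) * theta_coeff a b k) * qbinom Q (2 * n) (int n + k + 1)"
      using 1 unfolding 2 3 by (simp add: algebra_simps del: qbinom.simps)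
    also have "\<dots> = (1 + Q ^ (2 * n + 1)) * c k + f (k - 1) + g (k + 1)"
      unfolding mid left right f_def g_def c_def by (simp add: algebra_simps del: qbinom.simps)
    finally show ?thesis .
  qed
  have sf: "(\<Sum>k=-K..K. f (k - 1)) = (\<Sum>k=-K..K. f k)"
  proof -
    have "f (k - 1) = 0" if "\<bar>k\<bar> \<ge> K" for k
    proof -
      have "\<bar>k - 1\<bar> > int n" using that Suc.prems by linarith
      then show ?thesis using c0 by (simp add: f_def)
    qed
    then show ?thesis using sum_shift_int[of K "\<lambda>k. f (k - 1)"] by simp
  qed
  have sg: "(\<Sum>k=-K..K. g (k + 1)) = (\<Sum>k=-K..K. g k)"
    using sum_shift_int[of K g] c0 Suc.prems by (simp add: g_def)
  have "(\<Sum>k=-K..K. theta_coeff a b k * qbinom Q (2 * Suc n) (int (Suc n) + k))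
      = (\<Sum>k=-K..K. (1 + Q ^ (2 * n + 1)) * c k) + (\<Sum>k=-K..K. f k) + (\<Sum>k=-K..K. g k)"
    unfolding step by (simp only: sum.distrib sf sg)
  also have "\<dots> = (1 + Q ^ (2 * n + 1) - a * Q ^ n - b * Q ^ n) * (\<Sum>k=-K..K. c k)"
    unfolding f_def g_def sum_distrib_left[symmetric] by (simp add: algebra_simps)
  also have "1 + Q ^ (2 * n + 1) - a * Q ^ n - b * Q ^ n = (1 - a * Q ^ n) * (1 - b * Q ^ n)"
  proof -
    have "Q ^ (2 * n + 1) = Q ^ n * Q ^ n * (a * b)"
      unfolding Q_def by (simp only: mult_2 power_add power_one_right)
    then show ?thesis by (simp add: algebra_simps)
  qed
  also have "(\<Sum>k=-K..K. c k) = (\<Prod>j<n. (1 - a * Q ^ j) * (1 - b * Q ^ j))"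
    using Suc by (simp add: c_def Q_def)
  finally show ?case by (simp add: Q_def mult_ac)
qed

section \<open>Congruence of power series up to a given degree\<close>

definition fps_cong :: "nat \<Rightarrow> rat fps \<Rightarrow> rat fps \<Rightarrow> bool" where
  "fps_cong n f g \<longleftrightarrow> fps_X ^ Suc n dvd f - g"

lemma fps_cong_refl [simp]: "fps_cong n f f"
  by (simp add: fps_cong_def)

lemma fps_cong_sym: "fps_cong n f g \<Longrightarrow> fps_cong n g f"
  unfolding fps_cong_def by (metis dvd_minus_iff minus_diff_eq)

lemma fps_cong_trans [trans]: "fps_cong n f g \<Longrightarrow> fps_cong n g h \<Longrightarrow> fps_cong n f h"
  unfolding fps_cong_def using dvd_add[of _ "f - g" "g - h"] by simp

lemma fps_cong_eq_trans [trans]: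
  "f = g \<Longrightarrow> fps_cong n g h \<Longrightarrow> fps_cong n f h"
  "fps_cong n f g \<Longrightarrow> g = h \<Longrightarrow> fps_cong n f h"
  by simp_all

lemma fps_cong_mult:
  assumes "fps_cong n f g" "fps_cong n f' g'"
  shows "fps_cong n (f * f') (g * g')"
proof -
  have "f * f' - g * g' = (f - g) * f' + g * (f' - g')" by (simp add: algebra_simps)
  then show ?thesis using assms unfolding fps_cong_def by simp
qed

lemma fps_cong_diff: "fps_cong n f g \<Longrightarrow> fps_cong n f' g' \<Longrightarrow> fps_cong n (f - f') (g - g')"
  unfolding fps_cong_def using dvd_diff[of _ "f - g" "f' - g'"] by (simp add: algebra_simps)

lemma fps_cong_add: "fps_cong n f g \<Longrightarrow> fps_cong n f' g' \<Longrightarrow> fps_cong n (f + f') (g + g')"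
  unfolding fps_cong_def using dvd_add[of _ "f - g" "f' - g'"] by (simp add: algebra_simps)

lemma fps_cong_sum: "(\<And>i. i \<in> I \<Longrightarrow> fps_cong n (f i) (g i)) \<Longrightarrow> fps_cong n (sum f I) (sum g I)"
  unfolding fps_cong_def by (auto simp flip: sum_subtractf intro!: dvd_sum)

lemma fps_cong_cancel:
  assumes "fps_cong n (h * f) (h * g)" "fps_nth h 0 \<noteq> 0"
  shows "fps_cong n f g"
proof -
  have "fps_X ^ Suc n dvd h * (f - g)"
    using assms(1) by (simp add: fps_cong_def algebra_simps)
  then show ?thesis
    unfolding fps_cong_def using assms(2) by (subst (asm) dvd_mult_unit_iff') auto
qed

lemma fps_cong_iff: "fps_cong n f g \<longleftrightarrow> (\<forall>i\<le>n. fps_nth f i = fps_nth g i)"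
proof
  assume "fps_cong n f g"
  then obtain h where "f - g = fps_X ^ Suc n * h" unfolding fps_cong_def by (elim dvdE)
  then have "fps_nth (f - g) i = 0" if "i \<le> n" for i
    using that by (simp only: fps_X_power_mult_nth) simp
  then show "\<forall>i\<le>n. fps_nth f i = fps_nth g i" by simp
next
  assume *: "\<forall>i\<le>n. fps_nth f i = fps_nth g i"
  have "f - g = fps_X ^ Suc n * fps_shift (Suc n) (f - g)"
    using * by (intro fps_ext) (simp add: fps_X_power_mult_nth del: power_Suc)
  then show "fps_cong n f g" unfolding fps_cong_def by (metis dvd_triv_left)
qed

lemma fps_cong_X_power: "k > n \<Longrightarrow> fps_cong n (f * fps_X ^ k) 0"
  unfolding fps_cong_def diff_0_right by (intro dvd_mult le_imp_power_dvd) simp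

lemma qfact_cong:
  assumes "d > 0" "n \<le> L"
  shows "fps_cong n (qfact (fps_X ^ d) L) (qfact (fps_X ^ d) n)"
  using assms(2)
proof (induction rule: dec_induct)
  case base
  then show ?case by simp
next
  case (step L)
  have "n < d * Suc L" using step assms(1)
    by (metis le_imp_less_Suc less_le_trans mult_le_mono1 nat_mult_1 Suc_leI One_nat_def)
  then have "fps_cong n (1 - 1 * fps_X ^ (d * Suc L)) (1 - 0)"
    by (intro fps_cong_diff fps_cong_X_power fps_cong_refl)
  then have "fps_cong n (qfact (fps_X ^ d) L * (1 - (fps_X ^ d) ^ Suc L)) (qfact (fps_X ^ d) n * 1)"
    using step.IH by (intro fps_cong_mult) (simp_all add: power_mult del: power_Suc mult_Suc_right)
  then show ?case by (simp add: qfact_Suc del: power_Suc)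
qed

lemma fps_nth_prod_0: "fps_nth (\<Prod>i\<in>A. f i) 0 = (\<Prod>i\<in>A. fps_nth (f i :: rat fps) 0)"
  by (induction A rule: infinite_finite_induct) (simp_all add: fps_mult_nth_0)

lemma qfact_nth_0: "d > 0 \<Longrightarrow> fps_nth (qfact (fps_X ^ d :: rat fps) L) 0 = 1"
  by (induction L) (simp_all add: qfact_Suc fps_mult_nth_0 fps_nth_power_0 power_0_left
       flip: power_mult power_Suc)

text \<open>Since \<open>[N, r]\<close> is \<open>(q)_N / ((q)_r (q)_(N-r))\<close> and a product \<open>(q)_L\<close> modulo \<open>X ^ (n + 1)\<close> does
  not depend on \<open>L \<ge> n\<close>, the coefficient is congruent to \<open>1 / (q)_L\<close> as soon as \<open>r\<close> and \<open>N - r\<close> are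
  both at least \<open>n\<close>. Admitting a power \<open>q = X ^ d\<close> covers both uses, \<open>d = 1\<close> for Schur's sum and
  \<open>d = 5\<close> for the triple product.\<close>

lemma qfact_mult_qbinom_cong:
  assumes "d > 0" "n \<le> L" "int n \<le> r" "r + int n \<le> int N"
  shows "fps_cong n (qfact (fps_X ^ d) L * qbinom (fps_X ^ d) N r) 1"
proof -
  define k where "k = nat r"
  have r: "r = int k" and k: "n \<le> k" "n \<le> N - k" "k \<le> N" using assms by (auto simp: k_def)
  let ?P = "qfact (fps_X ^ d) :: nat \<Rightarrow> rat fps" and ?B = "qbinom (fps_X ^ d) N r :: rat fps"
  have "fps_cong n (?P n * (?P L * ?B)) (?P k * (?P (N - k) * ?B))"
    using k qfact_cong[OF assms(1)] assms(2)
    by (intro fps_cong_mult fps_cong_refl) (blast intro: fps_cong_sym fps_cong_trans)+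
  also have "?P k * (?P (N - k) * ?B) = ?P N"
    using qfact_mult_qbinom[of k N "fps_X ^ d :: rat fps"] k r by (simp add: mult_ac)
  also have "fps_cong n (?P N) (?P n * 1)"
    using qfact_cong[OF assms(1), of n N] k by simp
  finally show ?thesis
    by (rule fps_cong_cancel) (simp add: qfact_nth_0 assms)
qed

section \<open>The theta series of the first Rogers--Ramanujan identity\<close>

text \<open>The exponents \<open>0, 3, 2, 11, 9, \<dots>\<close>, an analogue of the pentagonal numbers with \<open>5\<close> in place of
  \<open>3\<close>.\<close>

definition pentagonal5 :: "int \<Rightarrow> nat" where
  "pentagonal5 k = nat (k * (5 * k + 1) div 2)"

lemma int_pentagonal5: "2 * int (pentagonal5 k) = k * (5 * k + 1)"
proof -
  have "k \<ge> 0 \<or> k \<le> -1" by linarith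
  then have "k * (5 * k + 1) \<ge> 0" by (auto simp: zero_le_mult_iff)
  moreover have "even (k * (5 * k + 1))" by simp
  ultimately show ?thesis unfolding pentagonal5_def by (simp add: dvd_div_mult_self)
qed

lemma abs_le_pentagonal5: "\<bar>k\<bar> \<le> int (pentagonal5 k)"
proof -
  have "k \<ge> 0 \<or> k \<le> -1" by linarith
  then have "0 \<le> k * (5 * k - 1)" "0 \<le> k * (5 * k + 3)" by (auto simp: zero_le_mult_iff)
  then have "2 * \<bar>k\<bar> \<le> 2 * int (pentagonal5 k)"
    unfolding int_pentagonal5 by (auto simp: abs_if algebra_simps)
  then show ?thesis by simp
qed

text \<open>With \<open>a = X ^ 3\<close> and \<open>b = X ^ 2\<close> the base of the triple product is \<open>a * b = X ^ 5\<close>, and its factors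
  are \<open>1 - X ^ j\<close> with \<open>j\<close> congruent to \<open>2\<close> or \<open>3\<close> modulo \<open>5\<close>.\<close>

abbreviation rr_theta :: "int \<Rightarrow> rat fps" where
  "rr_theta \<equiv> theta_coeff (fps_X ^ 3) (fps_X ^ 2)"

lemma rr_theta_eq: "rr_theta k = (if even k then 1 else -1) * fps_X ^ pentagonal5 k"
proof -
  have "3 * triangle k + 2 * triangle (k - 1) = pentagonal5 k"
    using int_triangle[of k] int_triangle[of "k - 1"] int_pentagonal5[of k]
    by (intro nat_eq_if_double_eq) (simp add: algebra_simps)
  then show ?thesis
    by (simp add: theta_coeff_def mult.assoc flip: power_mult power_add)
qed

lemma rr_theta_even: "rr_theta (2 * i) = fps_X ^ nat (i * (10 * i + 1))"
  by (simp add: rr_theta_eq pentagonal5_def mult.assoc algebra_simps)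

lemma rr_theta_odd: "rr_theta (2 * i + 1) = - (fps_X ^ nat ((2 * i + 1) * (5 * i + 3)))"
proof -
  have "(2 * i + 1) * (5 * (2 * i + 1) + 1) = 2 * ((2 * i + 1) * (5 * i + 3))"
    by (simp add: algebra_simps)
  then have "pentagonal5 (2 * i + 1) = nat ((2 * i + 1) * (5 * i + 3))"
    unfolding pentagonal5_def by (simp only: nonzero_mult_div_cancel_left)
  then show ?thesis by (simp add: rr_theta_eq)
qed

lemma rr_theta_cong_0: "\<bar>k\<bar> > int n \<Longrightarrow> fps_cong n (f * rr_theta k) 0"
  using abs_le_pentagonal5[of k]
    fps_cong_X_power[of n "pentagonal5 k" "f * (if even k then 1 else -1)"]
  by (simp add: rr_theta_eq mult.assoc)

text \<open>For \<open>\<bar>k\<bar> > n\<close> the theta term itself has degree above \<open>n\<close> and both sides are congruent to \<open>0\<close>;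
  the condition on \<open>r\<close> concerns the finitely many other \<open>k\<close>.\<close>

lemma rr_theta_mult_qbinom_cong:
  assumes "d > 0" "n \<le> L" "\<bar>k\<bar> \<le> int n \<Longrightarrow> int n \<le> r \<and> r + int n \<le> int N"
  shows "fps_cong n (qfact (fps_X ^ d) L * (rr_theta k * qbinom (fps_X ^ d) N r)) (rr_theta k)"
proof (cases "\<bar>k\<bar> \<le> int n")
  case True
  have "fps_cong n (rr_theta k * (qfact (fps_X ^ d) L * qbinom (fps_X ^ d) N r)) (rr_theta k * 1)"
    using assms True by (intro fps_cong_mult fps_cong_refl qfact_mult_qbinom_cong) auto
  then show ?thesis by (simp add: mult_ac)
next
  case False
  then have "fps_cong n ((qfact (fps_X ^ d) L * qbinom (fps_X ^ d) N r) * rr_theta k) 0"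
    and "fps_cong n (1 * rr_theta k) 0"
    by (intro rr_theta_cong_0; simp)+
  then have "fps_cong n ((qfact (fps_X ^ d) L * qbinom (fps_X ^ d) N r) * rr_theta k) (1 * rr_theta k)"
    by (rule fps_cong_trans[OF _ fps_cong_sym])
  then show ?thesis by (simp add: mult_ac)
qed

text \<open>Schur's sum pairs the indices \<open>2 i\<close> and \<open>2 i + 1\<close>, whereas the triple product runs over a symmetric
  interval; the two ranges differ in one extreme index.\<close>

lemma sum_int_pairs:
  fixes f :: "int \<Rightarrow> 'a::comm_monoid_add"
  shows "(\<Sum>k=-(2 * int K + 1)..2 * int K + 1. f k)
       = (\<Sum>i=-int K..int K. f (2 * i) + f (2 * i + 1)) + f (-(2 * int K + 1))"
proof -
  have ext: "(\<Sum>k=-(m + 1)..m + 1. g k) = g (-(m + 1)) + (\<Sum>k=-m..m. g k) + g (m + 1)"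
    if "m \<ge> 0" for m and g :: "int \<Rightarrow> 'a"
  proof -
    have "{-(m + 1)..m + 1} = insert (-(m + 1)) (insert (m + 1) {-m..m})" using that by auto
    then show ?thesis using that by (simp add: add_ac)
  qed
  show ?thesis
  proof (induction K)
    case 0
    then show ?case using ext[of 0 f] by (simp add: add_ac)
  next
    case (Suc K)
    have "(\<Sum>k=-(2 * int (Suc K) + 1)..2 * int (Suc K) + 1. f k)
        = f (-(2 * int K + 3)) + (f (-(2 * int K + 2)) + (\<Sum>k=-(2 * int K + 1)..2 * int K + 1. f k)
            + f (2 * int K + 2)) + f (2 * int K + 3)"
      using ext[of "2 * int K + 2" f] ext[of "2 * int K + 1" f] by (simp add: algebra_simps)
    moreover have "(\<Sum>i=-int (Suc K)..int (Suc K). f (2 * i) + f (2 * i + 1))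
       = (f (-(2 * int K + 2)) + f (-(2 * int K + 1)))
          + (\<Sum>i=-int K..int K. f (2 * i) + f (2 * i + 1)) + (f (2 * int K + 2) + f (2 * int K + 3))"
      using ext[of "int K" "\<lambda>i. f (2 * i) + f (2 * i + 1)"] by (simp add: algebra_simps)
    ultimately show ?case using Suc by (simp add: add_ac algebra_simps)
  qed
qed

text \<open>In the term with index \<open>k = 2 i\<close> or \<open>k = 2 i + 1\<close> and \<open>\<bar>k\<bar> \<le> n\<close>, the lower index of the Gaussian
  binomial differs from \<open>m\<close> by at most \<open>(5 n + 1) / 2\<close>. So \<open>m \<ge> 6 n + 3\<close> leaves it at distance at
  least \<open>n\<close> from both \<open>0\<close> and \<open>2 m\<close>.\<close>

lemma schur_even_cong:
  assumes "n \<le> L" "6 * n + 3 \<le> m"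
  shows "fps_cong n (qfact fps_X L * schur_even fps_X K m)
                    (\<Sum>i=-K..K. rr_theta (2 * i) + rr_theta (2 * i + 1))"
proof -
  let ?t = "\<lambda>k r. qfact fps_X L * (rr_theta k * qbinom fps_X (2 * m) r)"
  have "qfact fps_X L * schur_even fps_X K m
      = (\<Sum>i=-K..K. ?t (2 * i) (int m - 5 * i) + ?t (2 * i + 1) (int m - 5 * i - 3))"
    unfolding schur_even_def rr_theta_even rr_theta_odd sum_distrib_left
    by (simp only: right_diff_distrib mult_minus_left mult_minus_right add_uminus_conv_diff)
  moreover have "fps_cong n (\<Sum>i=-K..K. ?t (2 * i) (int m - 5 * i) + ?t (2 * i + 1) (int m - 5 * i - 3))
      (\<Sum>i=-K..K. rr_theta (2 * i) + rr_theta (2 * i + 1))"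
  proof (intro fps_cong_sum fps_cong_add)
    fix i
    show "fps_cong n (?t (2 * i) (int m - 5 * i)) (rr_theta (2 * i))"
      using rr_theta_mult_qbinom_cong[of 1 n L "2 * i" "int m - 5 * i" "2 * m"] assms by (simp add: abs_if split: if_splits)
    show "fps_cong n (?t (2 * i + 1) (int m - 5 * i - 3)) (rr_theta (2 * i + 1))"
      using rr_theta_mult_qbinom_cong[of 1 n L "2 * i + 1" "int m - 5 * i - 3" "2 * m"] assms by (simp add: abs_if split: if_splits)
  qed
  ultimately show ?thesis by simp
qed

lemma triple_product_cong:
  assumes "2 * n \<le> J" "int J < K"
  shows "fps_cong n (qfact (fps_X ^ 5) J
            * (\<Prod>j<J. (1 - fps_X ^ (5 * j + 3)) * (1 - fps_X ^ (5 * j + 2))))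
          (\<Sum>k=-K..K. rr_theta k)"
proof -
  have X5: "fps_X ^ 3 * fps_X ^ 2 = (fps_X ^ 5 :: rat fps)" by (simp flip: power_add)
  have "(\<Prod>j<J. (1 - fps_X ^ (5 * j + 3)) * (1 - fps_X ^ (5 * j + 2)))
      = (\<Prod>j<J. (1 - fps_X ^ 3 * (fps_X ^ 3 * fps_X ^ 2) ^ j)
               * (1 - fps_X ^ 2 * (fps_X ^ 3 * fps_X ^ 2) ^ j :: rat fps))"
    unfolding X5 by (simp add: add.commute flip: power_mult power_add)
  also have "\<dots> = (\<Sum>k=-K..K. rr_theta k * qbinom (fps_X ^ 5) (2 * J) (int J + k))"
    by (subst finite_triple_product[OF assms(2)]) (simp only: X5)
  finally have "qfact (fps_X ^ 5) J
            * (\<Prod>j<J. (1 - fps_X ^ (5 * j + 3)) * (1 - fps_X ^ (5 * j + 2)))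
       = (\<Sum>k=-K..K. qfact (fps_X ^ 5) J * (rr_theta k * qbinom (fps_X ^ 5) (2 * J) (int J + k)))"
    by (simp add: sum_distrib_left)
  also have "fps_cong n \<dots> (\<Sum>k=-K..K. rr_theta k)"
    by (intro fps_cong_sum rr_theta_mult_qbinom_cong) (use assms in auto)
  finally show ?thesis .
qed

lemma qfact_split:
  "qfact q (5 * J) = qfact (q ^ 5) J * (\<Prod>j<J. (1 - q ^ (5 * j + 3)) * (1 - q ^ (5 * j + 2)))
     * (\<Prod>j<J. (1 - q ^ (5 * j + 1)) * (1 - q ^ (5 * j + 4)))"
proof (induction J)
  case 0
  then show ?case by simp
next
  case (Suc J)
  have "5 * Suc J = Suc (Suc (Suc (Suc (Suc (5 * J)))))" by simp
  then have "qfact q (5 * Suc J) = qfact q (5 * J) * (1 - q ^ (5 * J + 1)) * (1 - q ^ (5 * J + 2))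
     * (1 - q ^ (5 * J + 3)) * (1 - q ^ (5 * J + 4)) * (1 - q ^ (5 * Suc J))"
    by (simp only: qfact_Suc) (simp add: numeral_eq_Suc)
  moreover have "qfact (q ^ 5) (Suc J) = qfact (q ^ 5) J * (1 - q ^ (5 * Suc J))"
    by (simp only: qfact_Suc power_mult)
  ultimately show ?case using Suc by (simp add: mult_ac del: mult_Suc_right power_Suc)
qed

text \<open>Multiplied by \<open>(X)_(5J)\<close>, Schur's sum becomes the theta series, which by the triple product is the
  part of \<open>(X)_(5J)\<close> with residues \<open>0\<close>, \<open>2\<close> and \<open>3\<close>. Cancelling that part leaves the residues \<open>1\<close> and
  \<open>4\<close>.\<close>

lemma schur_even_mult_prod_cong:
  assumes "6 * n + 3 \<le> m" "2 * n \<le> J" "J \<le> 2 * K"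
  shows "fps_cong n ((\<Prod>j<J. (1 - fps_X ^ (5 * j + 1)) * (1 - fps_X ^ (5 * j + 4)))
             * schur_even fps_X (int K) m) 1"
proof -
  let ?A = "qfact (fps_X ^ 5) J
            * (\<Prod>j<J. (1 - fps_X ^ (5 * j + 3)) * (1 - fps_X ^ (5 * j + 2))) :: rat fps"
  let ?B = "(\<Prod>j<J. (1 - fps_X ^ (5 * j + 1)) * (1 - fps_X ^ (5 * j + 4))) :: rat fps"
  let ?K = "2 * int K + 1"
  have "?A * (?B * schur_even fps_X (int K) m) = qfact fps_X (5 * J) * schur_even fps_X (int K) m"
    unfolding qfact_split by (simp only: mult_ac)
  also have "fps_cong n \<dots> (\<Sum>i=-int K..int K. rr_theta (2 * i) + rr_theta (2 * i + 1))"
    using assms by (intro schur_even_cong) auto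
  also have "(\<Sum>i=-int K..int K. rr_theta (2 * i) + rr_theta (2 * i + 1))
      = (\<Sum>k=-?K..?K. rr_theta k) - 1 * rr_theta (- ?K)"
    by (simp only: sum_int_pairs) simp
  also have "fps_cong n \<dots> ((\<Sum>k=-?K..?K. rr_theta k) - 0)"
    using assms by (intro fps_cong_diff fps_cong_refl rr_theta_cong_0) auto
  also have "fps_cong n ((\<Sum>k=-?K..?K. rr_theta k) - 0) (?A * 1)"
    using triple_product_cong[of n J ?K] assms by (auto intro: fps_cong_sym)
  finally show ?thesis
    by (rule fps_cong_cancel)
       (simp add: fps_mult_nth_0 qfact_nth_0 fps_nth_prod_0 fps_nth_power_0 power_0_left)
qed

section \<open>Generating functions of classes of partitions\<close>

definition gf :: "(nat list \<Rightarrow> bool) \<Rightarrow> rat fps" where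
  "gf P = Abs_fps (\<lambda>n. of_nat (card {l. is_partition n l \<and> P l}))"

lemma gf_nth: "fps_nth (gf P) n = of_nat (card {l. is_partition n l \<and> P l})"
  by (simp add: gf_def)

lemma finite_partitions_with: "finite {l. is_partition n l \<and> P l}"
  by (rule finite_subset[OF _ finite_partitions]) auto

lemma gf_eqI:
  assumes "\<And>n l. is_partition n l \<Longrightarrow> P l \<longleftrightarrow> Q l"
  shows "gf P = gf Q"
proof -
  have "{l. is_partition n l \<and> P l} = {l. is_partition n l \<and> Q l}" for n
    using assms by auto
  then show ?thesis unfolding gf_def by (simp only:)
qed

lemma gf_split: "gf P = gf (\<lambda>l. P l \<and> Q l) + gf (\<lambda>l. P l \<and> \<not> Q l)"
proof (rule fps_ext)
  fix n
  have "{l. is_partition n l \<and> P l}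
      = {l. is_partition n l \<and> P l \<and> Q l} \<union> {l. is_partition n l \<and> P l \<and> \<not> Q l}" by auto
  then have "card {l. is_partition n l \<and> P l}
      = card {l. is_partition n l \<and> P l \<and> Q l} + card {l. is_partition n l \<and> P l \<and> \<not> Q l}"
    by (simp only:) (rule card_Un_disjoint; auto simp: finite_partitions_with)
  then show "fps_nth (gf P) n = fps_nth (gf (\<lambda>l. P l \<and> Q l) + gf (\<lambda>l. P l \<and> \<not> Q l)) n"
    by (simp add: gf_def)
qed

lemma gf_shift:
  assumes "\<And>n. bij_betw \<phi> {l. is_partition n l \<and> P l} {l. is_partition (n + s) l \<and> P' l}"
    and "\<And>n l. is_partition n l \<Longrightarrow> P' l \<Longrightarrow> s \<le> n"
  shows "gf P' = fps_X ^ s * gf P"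
proof (rule fps_ext)
  fix n
  show "fps_nth (gf P') n = fps_nth (fps_X ^ s * gf P) n"
  proof (cases "s \<le> n")
    case True
    then show ?thesis
      using bij_betw_same_card[OF assms(1)[of "n - s"]]
      by (simp add: gf_def fps_X_power_mult_nth)
  next
    case False
    then have "card {l. is_partition n l \<and> P' l} = 0" using assms(2) by (auto intro: card_eq_0_iff[THEN iffD2])
    then show ?thesis using False by (simp only: gf_def fps_X_power_mult_nth) simp
  qed
qed

lemma gf_Nil: "gf (\<lambda>l. l = []) = 1"
proof (rule fps_ext)
  fix n
  have "{l. is_partition n l \<and> l = []} = (if n = 0 then {[]} else {})"
    by (auto simp: is_partition_def)
  then show "fps_nth (gf (\<lambda>l. l = [])) n = fps_nth 1 n" by (simp add: gf_def)
qed

lemma part_le: "is_partition n l \<Longrightarrow> p \<in> set l \<Longrightarrow> p \<le> n"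
  unfolding is_partition_def using member_le_sum_list by auto

lemma partition_eqI:
  assumes "is_partition n l" "is_partition n' l'" "mset l = mset l'"
  shows "l = l'"
proof -
  have "sorted (rev l)" "sorted (rev l')" using assms by (auto simp: is_partition_def sorted_wrt_rev)
  then have "rev l = rev l'" using assms(3) by (metis mset_rev properties_for_sort)
  then show ?thesis by simp
qed

section \<open>Partitions with parts in a given set\<close>

abbreviation parts_gf :: "nat set \<Rightarrow> rat fps" where
  "parts_gf S \<equiv> gf (\<lambda>l. set l \<subseteq> S)"

text \<open>Inserting one more copy of \<open>s\<close> is a bijection from all partitions with parts in \<open>S\<close> onto those in
  which \<open>s\<close> occurs.\<close>

lemma parts_gf_remove:
  assumes "s \<in> S" "s > 0"
  shows "(1 - fps_X ^ s) * parts_gf S = parts_gf (S - {s})"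
proof -
  define ins where "ins l = rev (insort s (rev l))" for l :: "nat list"
  define rem where "rem l = rev (remove1 s (rev l))" for l :: "nat list"
  have mset_ins: "mset (ins l) = add_mset s (mset l)" for l by (simp add: ins_def)
  have mset_rem: "mset (rem l) = mset l - {#s#}" for l by (simp add: rem_def)
  have set_ins: "set (ins l) = insert s (set l)" for l by (simp add: ins_def set_insort_key)
  have set_rem: "set (rem l) \<subseteq> set l" for l
    using set_remove1_subset[of s "rev l"] by (simp add: rem_def)
  have ins: "is_partition (n + s) (ins l)" if "is_partition n l" for n l
  proof -
    have "sorted (rev l)" using that by (simp add: is_partition_def sorted_wrt_rev)
    then have "sorted_wrt (\<ge>) (ins l)" by (simp add: ins_def sorted_insort sorted_wrt_rev)
    moreover have "sum_mset (mset (ins l)) = sum_mset (mset l) + s"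
      by (simp add: mset_ins)
    ultimately show ?thesis
      using that assms(2) by (auto simp: is_partition_def set_ins sum_mset_sum_list)
  qed
  have rem: "is_partition n (rem l)" if "is_partition (n + s) l" "s \<in> set l" for n l
  proof -
    have "sorted (rev l)" using that by (simp add: is_partition_def sorted_wrt_rev)
    then have "sorted_wrt (\<ge>) (rem l)" by (simp add: rem_def sorted_remove1 sorted_wrt_rev)
    moreover have "mset l = add_mset s (mset (rem l))" using that(2) by (simp add: mset_rem)
    then have "sum_mset (mset l) = s + sum_mset (mset (rem l))" by (simp only: sum_mset.add_mset)
    then have "sum_list l = s + sum_list (rem l)" by (simp only: sum_mset_sum_list)
    ultimately show ?thesis
      using that set_rem[of l] by (auto simp: is_partition_def)
  qed
  have "gf (\<lambda>l. set l \<subseteq> S \<and> s \<in> set l) = fps_X ^ s * parts_gf S"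
  proof (rule gf_shift[where \<phi> = ins])
    fix n
    show "bij_betw ins {l. is_partition n l \<and> set l \<subseteq> S}
            {l. is_partition (n + s) l \<and> set l \<subseteq> S \<and> s \<in> set l}"
    proof (rule bij_betw_byWitness[where f' = rem]; intro ballI image_subsetI)
      fix l assume l: "l \<in> {l. is_partition n l \<and> set l \<subseteq> S}"
      then have "is_partition n (rem (ins l))" using rem[OF ins] by (simp add: set_ins)
      then show "rem (ins l) = l"
        by (rule partition_eqI[where n' = n]) (use l in \<open>simp_all add: mset_ins mset_rem\<close>)
      show "ins l \<in> {l. is_partition (n + s) l \<and> set l \<subseteq> S \<and> s \<in> set l}"
        using l ins assms by (simp add: set_ins)
    next
      fix l assume l: "l \<in> {l. is_partition (n + s) l \<and> set l \<subseteq> S \<and> s \<in> set l}"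
      then have "is_partition (n + s) (ins (rem l))" using ins[OF rem] by simp
      then show "ins (rem l) = l"
        by (rule partition_eqI[where n' = "n + s"]) (use l in \<open>simp_all add: mset_ins mset_rem\<close>)
      show "rem l \<in> {l. is_partition n l \<and> set l \<subseteq> S}"
        using l rem set_rem[of l] by auto
    qed
  qed (auto dest: part_le)
  moreover have "gf (\<lambda>l. set l \<subseteq> S \<and> s \<notin> set l) = parts_gf (S - {s})"
    by (intro gf_eqI) auto
  ultimately have "parts_gf S = fps_X ^ s * parts_gf S + parts_gf (S - {s})"
    using gf_split[of "\<lambda>l. set l \<subseteq> S" "\<lambda>l. s \<in> set l"] by simp
  then show ?thesis by (simp add: algebra_simps)
qed

lemma prod_mult_parts_gf:
  assumes "finite S" "0 \<notin> S"
  shows "(\<Prod>s\<in>S. 1 - fps_X ^ s) * parts_gf S = 1"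
  using assms
proof (induction S)
  case empty
  then show ?case using gf_Nil by simp
next
  case (insert s S)
  have "(\<Prod>s\<in>insert s S. 1 - fps_X ^ s) * parts_gf (insert s S)
      = (\<Prod>s\<in>S. 1 - fps_X ^ s) * ((1 - fps_X ^ s) * parts_gf (insert s S))"
    using insert.hyps by (simp add: mult_ac)
  also have "(1 - fps_X ^ s) * parts_gf (insert s S) = parts_gf S"
    using parts_gf_remove[of s "insert s S"] insert by simp
  also have "(\<Prod>s\<in>S. 1 - fps_X ^ s) * parts_gf S = 1"
    using insert by simp
  finally show ?case .
qed

lemma parts_gf_cong: "n \<le> m \<Longrightarrow> fps_cong n (parts_gf S) (parts_gf (S \<inter> {..m}))"
proof -
  assume "n \<le> m"
  have "set l \<subseteq> {..m}" if "i \<le> n" "is_partition i l" for i l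
    using part_le[OF that(2)] that(1) \<open>n \<le> m\<close> by (meson atMost_iff le_trans subsetI)
  then have "{l. is_partition i l \<and> set l \<subseteq> S} = {l. is_partition i l \<and> set l \<subseteq> S \<inter> {..m}}"
    if "i \<le> n" for i
    using that by blast
  then show ?thesis by (simp add: fps_cong_iff gf_def)
qed

definition rr_parts :: "nat set" where
  "rr_parts = {p. p mod 5 = 1 \<or> p mod 5 = 4}"

lemma prod_rr_parts:
  "(\<Prod>s\<in>rr_parts \<inter> {..5 * J}. f s) = (\<Prod>j<J. f (5 * j + 1) * f (5 * j + 4 :: nat) :: 'a::comm_monoid_mult)"
proof (induction J)
  case 0
  then show ?case by (simp add: rr_parts_def)
next
  case (Suc J)
  have "rr_parts \<inter> {..5 * Suc J} = insert (5 * J + 1) (insert (5 * J + 4) (rr_parts \<inter> {..5 * J}))"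
  proof (intro equalityI subsetI)
    fix p assume "p \<in> rr_parts \<inter> {..5 * Suc J}"
    then have "(p mod 5 = 1 \<or> p mod 5 = 4) \<and> p \<le> 5 * J + 5" by (simp add: rr_parts_def)
    then have "p = 5 * J + 1 \<or> p = 5 * J + 4 \<or> ((p mod 5 = 1 \<or> p mod 5 = 4) \<and> p \<le> 5 * J)"
      by presburger
    then show "p \<in> insert (5 * J + 1) (insert (5 * J + 4) (rr_parts \<inter> {..5 * J}))"
      by (auto simp: rr_parts_def)
  next
    fix p assume "p \<in> insert (5 * J + 1) (insert (5 * J + 4) (rr_parts \<inter> {..5 * J}))"
    then show "p \<in> rr_parts \<inter> {..5 * Suc J}" by (auto simp: rr_parts_def)
  qed
  then have "(\<Prod>s\<in>rr_parts \<inter> {..5 * Suc J}. f s)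
      = f (5 * J + 1) * (f (5 * J + 4) * (\<Prod>s\<in>rr_parts \<inter> {..5 * J}. f s))"
    by (simp only:) (subst prod.insert; simp)
  then show ?case using Suc by (simp add: mult_ac)
qed

section \<open>Partitions with difference at least 2\<close>

abbreviation gap_gf :: "rat fps" where
  "gap_gf \<equiv> gf difference_at_least_2"

definition bounded_gap_gf :: "nat \<Rightarrow> rat fps" where
  "bounded_gap_gf m = gf (\<lambda>l. difference_at_least_2 l \<and> (\<forall>p\<in>set l. p \<le> m))"

lemma difference_at_least_2_simps [simp]:
  "difference_at_least_2 []"
  "difference_at_least_2 [x]"
  "difference_at_least_2 (x # y # zs) \<longleftrightarrow> y + 2 \<le> x \<and> difference_at_least_2 (y # zs)"
proof -
  have "difference_at_least_2 (x # y # zs) \<longleftrightarrow> int x - int y \<ge> 2 \<and> difference_at_least_2 (y # zs)"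
    by (simp add: difference_at_least_2_def All_less_Suc2)
  then show "difference_at_least_2 (x # y # zs) \<longleftrightarrow> y + 2 \<le> x \<and> difference_at_least_2 (y # zs)"
    by linarith
qed (simp_all add: difference_at_least_2_def)

lemma is_partition_Cons:
  "is_partition n (x # xs) \<longleftrightarrow> (\<forall>y\<in>set xs. y \<le> x) \<and> 1 \<le> x \<and> x \<le> n \<and> is_partition (n - x) xs"
proof -
  have "x + sum_list xs = n \<longleftrightarrow> x \<le> n \<and> sum_list xs = n - x" by linarith
  then show ?thesis unfolding is_partition_def by (simp only: sorted_wrt.simps list.set sum_list.Cons) blast
qed

lemma bounded_gap_gf_0: "bounded_gap_gf 0 = 1"
proof -
  have "bounded_gap_gf 0 = gf (\<lambda>l. l = [])"
    unfolding bounded_gap_gf_def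
  proof (rule gf_eqI)
    fix n l assume "is_partition n l"
    then show "(difference_at_least_2 l \<and> (\<forall>p\<in>set l. p \<le> 0)) \<longleftrightarrow> l = []"
      by (cases l) (simp_all add: is_partition_Cons)
  qed
  then show ?thesis by (simp add: gf_Nil)
qed

text \<open>Either \<open>Suc m\<close> does not occur, or it is the largest part and the other parts are at most \<open>m - 1\<close>.
  For \<open>m = 0\<close> the truncated \<open>m - 1\<close> is \<open>0\<close>, which is right: nothing can accompany the part \<open>1\<close>.\<close>

lemma bounded_gap_gf_Suc:
  "bounded_gap_gf (Suc m) = bounded_gap_gf m + fps_X ^ Suc m * bounded_gap_gf (m - 1)"
proof -
  let ?P = "\<lambda>m l. difference_at_least_2 l \<and> (\<forall>p\<in>set l. p \<le> m)"
  have "gf (\<lambda>l. ?P (Suc m) l \<and> Suc m \<in> set l) = fps_X ^ Suc m * gf (?P (m - 1))"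
  proof (rule gf_shift[where \<phi> = "Cons (Suc m)"])
    fix n
    show "bij_betw ((#) (Suc m)) {l. is_partition n l \<and> ?P (m - 1) l}
            {l. is_partition (n + Suc m) l \<and> ?P (Suc m) l \<and> Suc m \<in> set l}"
    proof (rule bij_betwI')
      fix l l' show "(Suc m # l = Suc m # l') = (l = l')" by simp
    next
      fix l assume "l \<in> {l. is_partition n l \<and> ?P (m - 1) l}"
      then show "Suc m # l \<in> {l. is_partition (n + Suc m) l \<and> ?P (Suc m) l \<and> Suc m \<in> set l}"
        by (cases l) (auto simp: is_partition_Cons)
    next
      fix l assume l: "l \<in> {l. is_partition (n + Suc m) l \<and> ?P (Suc m) l \<and> Suc m \<in> set l}"
      then obtain x xs where [simp]: "l = x # xs" by (cases l) auto
      have x: "x = Suc m" using l by (force simp: is_partition_Cons)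
      have "is_partition n xs" using l by (simp add: is_partition_Cons x)
      moreover have "?P (m - 1) xs"
      proof (cases xs)
        case (Cons y ys)
        then have "y + 2 \<le> Suc m" "difference_at_least_2 xs" "\<forall>p\<in>set xs. p \<le> y"
          using l x by (simp_all add: is_partition_Cons)
        then show ?thesis by fastforce
      qed simp
      ultimately show "\<exists>l'\<in>{l. is_partition n l \<and> ?P (m - 1) l}. l = Suc m # l'"
        using x by auto
    qed
  qed (auto dest: part_le)
  moreover have "gf (\<lambda>l. ?P (Suc m) l \<and> Suc m \<notin> set l) = gf (?P m)"
    by (rule gf_eqI) (auto simp: le_Suc_eq)
  moreover have "gf (?P (Suc m)) = gf (\<lambda>l. ?P (Suc m) l \<and> Suc m \<in> set l)
      + gf (\<lambda>l. ?P (Suc m) l \<and> Suc m \<notin> set l)"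
    by (rule gf_split)
  ultimately show ?thesis
    unfolding bounded_gap_gf_def by (simp only: add.commute)
qed

text \<open>Both sides satisfy the same recurrence. For \<open>m = 0\<close> the truncated bound \<open>2 * m - 1 = 0\<close> agrees with
  \<open>schur_even\<close>, as both series are \<open>1\<close>.\<close>

lemma schur_eq_bounded_gap_gf:
  assumes "int m < K"
  shows "schur_odd fps_X K m = bounded_gap_gf (2 * m)
       \<and> schur_even fps_X K m = bounded_gap_gf (2 * m - 1)"
  using assms
proof (induction m)
  case 0
  then show ?case by (simp add: schur_0 bounded_gap_gf_0)
next
  case (Suc m)
  then have IH: "schur_odd fps_X K m = bounded_gap_gf (2 * m)"
    "schur_even fps_X K m = bounded_gap_gf (2 * m - 1)" by auto
  have "int m + 1 < K" using Suc.prems by simp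
  then have "schur_even fps_X K (Suc m)
      = bounded_gap_gf (2 * m) + fps_X ^ (2 * m + 1) * bounded_gap_gf (2 * m - 1)"
    by (simp only: schur_even_Suc IH)
  also have "\<dots> = bounded_gap_gf (2 * m + 1)"
    using bounded_gap_gf_Suc[of "2 * m"] by (simp only: Suc_eq_plus1)
  finally have even: "schur_even fps_X K (Suc m) = bounded_gap_gf (2 * m + 1)" .
  have "schur_odd fps_X K (Suc m)
      = bounded_gap_gf (2 * m + 1) + fps_X ^ (2 * m + 2) * bounded_gap_gf (2 * m)"
    by (simp only: schur_odd_Suc IH even)
  also have "\<dots> = bounded_gap_gf (2 * m + 2)"
  proof -
    have idx: "Suc (2 * m + 1) = 2 * m + 2" "2 * m + 1 - 1 = 2 * m" by simp_all
    show ?thesis using bounded_gap_gf_Suc[of "2 * m + 1"] unfolding idx by (rule sym)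
  qed
  finally have "schur_odd fps_X K (Suc m) = bounded_gap_gf (2 * m + 2)" .
  moreover have idx: "2 * Suc m = 2 * m + 2" "2 * m + 2 - 1 = 2 * m + 1" by simp_all
  ultimately show ?case unfolding idx using even by (intro conjI)
qed

text \<open>The coefficient of \<open>X ^ n\<close> is not affected by a bound on the parts beyond \<open>n\<close>, so it can be read
  off Schur's sum on the left and from a finite product on the right.\<close>

theorem rogers_ramanujan: "gap_gf = parts_gf rr_parts"
proof (rule fps_ext)
  fix n
  \<comment> \<open>Values for which every truncation is harmless up to degree \<open>n\<close>; \<open>m + 1\<close> bounds the
    indices of the nonzero terms of Schur's sum.\<close>
  define m J K :: nat where "m = 6 * n + 3" and "J = 2 * n" and "K = m + 1"
  let ?B = "(\<Prod>j<J. (1 - fps_X ^ (5 * j + 1)) * (1 - fps_X ^ (5 * j + 4))) :: rat fps"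
  have "\<forall>p\<in>set l. p \<le> 2 * m - 1" if "is_partition n l" for l
  proof -
    have "n \<le> 2 * m - 1" by (simp add: m_def)
    then show ?thesis using part_le[OF that] by (meson order_trans)
  qed
  then have "{l. is_partition n l \<and> difference_at_least_2 l}
      = {l. is_partition n l \<and> difference_at_least_2 l \<and> (\<forall>p\<in>set l. p \<le> 2 * m - 1)}"
    by blast
  then have "fps_nth gap_gf n = fps_nth (bounded_gap_gf (2 * m - 1)) n"
    by (simp add: gf_def bounded_gap_gf_def)
  also have "bounded_gap_gf (2 * m - 1) = schur_even fps_X (int K) m"
    using schur_eq_bounded_gap_gf[of m "int K"] by (simp add: K_def)
  also have "fps_nth (schur_even fps_X (int K) m) n = fps_nth (parts_gf (rr_parts \<inter> {..5 * J})) n"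
  proof -
    have "0 \<notin> rr_parts \<inter> {..5 * J}" "finite (rr_parts \<inter> {..5 * J})"
      by (simp_all add: rr_parts_def)
    then have parts: "?B * parts_gf (rr_parts \<inter> {..5 * J}) = 1"
      using prod_mult_parts_gf[of "rr_parts \<inter> {..5 * J}"] unfolding prod_rr_parts by blast
    have "fps_cong n (?B * schur_even fps_X (int K) m) (?B * parts_gf (rr_parts \<inter> {..5 * J}))"
      unfolding parts by (rule schur_even_mult_prod_cong) (simp_all add: m_def J_def K_def)
    moreover have "fps_nth ?B 0 \<noteq> 0"
      by (simp add: fps_mult_nth_0 fps_nth_prod_0 fps_nth_power_0 power_0_left)
    ultimately show ?thesis using fps_cong_cancel fps_cong_iff by blast
  qed
  also have "\<dots> = fps_nth (parts_gf rr_parts) n"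
    using parts_gf_cong[of n "5 * J" rr_parts] by (simp add: fps_cong_iff J_def)
  finally show "fps_nth gap_gf n = fps_nth (parts_gf rr_parts) n" .
qed

section \<open>The slack of the largest part\<close>

text \<open>The largest part can be lowered by at most the slack if the gaps are to stay at least \<open>2\<close>. A single
  part may be lowered to \<open>0\<close>, which is then dropped; correspondingly the empty partition has slack
  \<open>0\<close> and is raised to a single part.\<close>

fun slack :: "nat list \<Rightarrow> nat" where
  "slack [] = 0"
| "slack [x] = x"
| "slack (x # y # zs) = x - y - 2"

fun raise_largest :: "nat \<Rightarrow> nat list \<Rightarrow> nat list" where
  "raise_largest s [] = [s]"
| "raise_largest s (x # xs) = (x + s) # xs"

fun lower_largest :: "nat \<Rightarrow> nat list \<Rightarrow> nat list" where
  "lower_largest s [] = []"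
| "lower_largest s [x] = (if x = s then [] else [x - s])"
| "lower_largest s (x # y # zs) = (x - s) # y # zs"

definition slack_gf :: "(nat \<Rightarrow> bool) \<Rightarrow> rat fps" where
  "slack_gf Q = gf (\<lambda>l. difference_at_least_2 l \<and> Q (slack l))"

lemma slack_le: "is_partition n l \<Longrightarrow> slack l \<le> n"
  by (cases l rule: slack.cases) (auto simp: is_partition_Cons)

lemma slack_gf_shift:
  assumes "s > 0"
  shows "slack_gf (\<lambda>j. s \<le> j \<and> Q (j - s)) = fps_X ^ s * slack_gf Q"
  unfolding slack_gf_def
proof (rule gf_shift[where \<phi> = "raise_largest s"])
  fix n
  let ?A = "{l. is_partition n l \<and> difference_at_least_2 l \<and> Q (slack l)}"
  let ?B = "{l. is_partition (n + s) l \<and> difference_at_least_2 l \<and> s \<le> slack l \<and> Q (slack l - s)}"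
  show "bij_betw (raise_largest s) ?A ?B"
  proof (rule bij_betw_byWitness[where f' = "lower_largest s"])
    show "\<forall>l\<in>?A. lower_largest s (raise_largest s l) = l"
    proof
      fix l assume "l \<in> ?A"
      then show "lower_largest s (raise_largest s l) = l"
        by (cases l rule: slack.cases) (auto simp: is_partition_Cons)
    qed
  next
    show "\<forall>l\<in>?B. raise_largest s (lower_largest s l) = l"
    proof
      fix l assume "l \<in> ?B"
      then show "raise_largest s (lower_largest s l) = l"
        using assms by (cases l rule: slack.cases) auto
    qed
  next
    show "raise_largest s ` ?A \<subseteq> ?B"
    proof (intro image_subsetI)
      fix l assume "l \<in> ?A"
      then show "raise_largest s l \<in> ?B"
        using assms by (cases l rule: slack.cases) (auto simp: is_partition_def)
    qed
  next
    show "lower_largest s ` ?B \<subseteq> ?A"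
    proof (intro image_subsetI)
      fix l assume "l \<in> ?B"
      then show "lower_largest s l \<in> ?A"
        using assms by (cases l rule: slack.cases) (auto simp: is_partition_def add.commute)
    qed
  qed
qed (auto dest: slack_le)

text \<open>Splitting at slack \<open>N\<close>: from \<open>N\<close> on, lowering the largest part by \<open>N\<close> keeps the residue, and below
  \<open>N\<close> the condition on the residue says that the slack is below \<open>M\<close>. Splitting all partitions at
  slack \<open>M\<close> counts the latter.\<close>

lemma slack_gf_mod:
  assumes "0 < M" "M < N"
  shows "(1 - fps_X ^ N) * slack_gf (\<lambda>j. j mod N < M) = (1 - fps_X ^ M) * gap_gf"
proof -
  have split: "slack_gf Q = slack_gf (\<lambda>j. s \<le> j \<and> Q j) + slack_gf (\<lambda>j. \<not> s \<le> j \<and> Q j)" for s Q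
    unfolding slack_gf_def
    using gf_split[of "\<lambda>l. difference_at_least_2 l \<and> Q (slack l)" "\<lambda>l. s \<le> slack l"]
    by (simp add: conj_ac)
  have "slack_gf (\<lambda>j. j mod N < M) = fps_X ^ N * slack_gf (\<lambda>j. j mod N < M)
          + slack_gf (\<lambda>j. \<not> N \<le> j \<and> j mod N < M)"
  proof -
    have "(\<lambda>j. N \<le> j \<and> j mod N < M) = (\<lambda>j. N \<le> j \<and> (j - N) mod N < M)"
      by (auto simp: le_mod_geq)
    then show ?thesis
      using split[of "\<lambda>j. j mod N < M" N] slack_gf_shift[of N "\<lambda>j. j mod N < M"] assms by simp
  qed
  moreover have "slack_gf (\<lambda>j. \<not> N \<le> j \<and> j mod N < M) = slack_gf (\<lambda>j. \<not> M \<le> j \<and> True)"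
    using assms by (intro arg_cong[where f = slack_gf]) (auto simp: fun_eq_iff)
  moreover have "slack_gf (\<lambda>_. True)
     = fps_X ^ M * slack_gf (\<lambda>_. True) + slack_gf (\<lambda>j. \<not> M \<le> j \<and> True)"
    using split[of "\<lambda>_. True" M] slack_gf_shift[of M "\<lambda>_. True"] assms by simp
  moreover have "slack_gf (\<lambda>_. True) = gap_gf" by (simp add: slack_gf_def)
  ultimately have "(1 - fps_X ^ N) * slack_gf (\<lambda>j. j mod N < M) = slack_gf (\<lambda>j. \<not> M \<le> j \<and> True)"
    and "(1 - fps_X ^ M) * gap_gf = slack_gf (\<lambda>j. \<not> M \<le> j \<and> True)"
    by (simp_all add: left_diff_distrib diff_eq_eq add.commute)
  then show ?thesis by (simp only:)
qed

lemma parts_gf_exchange: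
  assumes "M \<in> S" "0 < M" "N \<notin> S" "0 < N"
  shows "(1 - fps_X ^ N) * parts_gf (insert N (S - {M})) = (1 - fps_X ^ M) * parts_gf S"
proof -
  have "insert N (S - {M}) - {N} = S - {M}" using assms by auto
  then show ?thesis
    using parts_gf_remove[of N "insert N (S - {M})"] parts_gf_remove[of M S] assms by simp
qed

section \<open>The partition identity\<close>

text \<open>On nonempty lists the difference of integers is a natural number, namely the slack, and a natural
  number is congruent to some \<open>r < M\<close> modulo \<open>N\<close> iff its residue is below \<open>M\<close>, because \<open>M \<le> N\<close>.\<close>

lemma slack_condition_iff:
  assumes "difference_at_least_2 l" "l \<noteq> []" "M \<le> N"
  shows "slack l mod N < M \<longleftrightarrow>
      (length l = 1 \<and> (\<exists>r<M. [l ! 0 = r] (mod N))) \<or>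
      (length l \<ge> 2 \<and> (\<exists>r<M. [int (l ! 0) - int (l ! 1) - 2 = int r] (mod int N)))"
proof -
  have res: "(\<exists>r<M. [x = r] (mod N)) \<longleftrightarrow> x mod N < M" for x
    using assms(3) unfolding cong_def by (metis mod_less mod_mod_trivial order_less_le_trans)
  show ?thesis
  proof (cases l rule: slack.cases)
    case (3 x y zs)
    then have "int (l ! 0) - int (l ! 1) - 2 = int (slack l)" using assms(1) by auto
    then show ?thesis by (simp only: cong_int_iff res) (simp add: 3)
  qed (use assms(2) res in auto)
qed

theorem corollary5p1:
  fixes M N n :: nat
  assumes "M > 0" and "[M = 1] (mod 5) \<or> [M = 4] (mod 5)"
    and "N > M" and "\<not> ([N = 1] (mod 5) \<or> [N = 4] (mod 5))"
    and "n \<ge> 1"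
  shows "card {l. is_partition n l \<and>
                  (\<forall>p\<in>set l. (([p = 1] (mod 5) \<or> [p = 4] (mod 5)) \<and> p \<noteq> M) \<or> p = N)}
       = card {l. is_partition n l \<and> difference_at_least_2 l \<and>
                  ((length l = 1 \<and> (\<exists>r<M. [l ! 0 = r] (mod N))) \<or>
                   (length l \<ge> 2 \<and>
                     (\<exists>r<M. [int (l ! 0) - int (l ! 1) - 2 = int r] (mod int N))))}"
    (is "card ?A = card ?B")
proof -
  have rr: "([p = 1] (mod 5) \<or> [p = 4] (mod 5)) \<longleftrightarrow> p \<in> rr_parts" for p :: nat
    by (simp add: rr_parts_def cong_def)
  have "M \<in> rr_parts" "N \<notin> rr_parts" using assms rr by blast+
  then have "(1 - fps_X ^ N) * parts_gf (insert N (rr_parts - {M}))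
      = (1 - fps_X ^ N) * slack_gf (\<lambda>j. j mod N < M)"
    using assms parts_gf_exchange[of M rr_parts N] slack_gf_mod[of M N]
    by (simp add: rogers_ramanujan)
  moreover have "1 - fps_X ^ N \<noteq> (0 :: rat fps)"
  proof
    assume "1 - fps_X ^ N = (0 :: rat fps)"
    then have "fps_nth (1 - fps_X ^ N :: rat fps) 0 = 0" by simp
    then show False using assms by (simp add: fps_nth_power_0 power_0_left)
  qed
  ultimately have eq: "parts_gf (insert N (rr_parts - {M})) = slack_gf (\<lambda>j. j mod N < M)"
    by simp
  have "?A = {l. is_partition n l \<and> set l \<subseteq> insert N (rr_parts - {M})}"
    unfolding rr by auto
  then have A: "of_nat (card ?A) = fps_nth (slack_gf (\<lambda>j. j mod N < M)) n"
    by (simp only: gf_nth flip: eq)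
  have "?B = {l. is_partition n l \<and> difference_at_least_2 l \<and> slack l mod N < M}"
  proof (intro Collect_cong conj_cong refl)
    fix l assume "is_partition n l" "difference_at_least_2 l"
    moreover from this have "l \<noteq> []" using assms(5) by (auto simp: is_partition_def)
    ultimately show "(length l = 1 \<and> (\<exists>r<M. [l ! 0 = r] (mod N)) \<or>
        length l \<ge> 2 \<and> (\<exists>r<M. [int (l ! 0) - int (l ! 1) - 2 = int r] (mod int N)))
      \<longleftrightarrow> slack l mod N < M"
      using assms(3) by (intro slack_condition_iff[symmetric]) simp_all
  qed
  then have B: "of_nat (card ?B) = fps_nth (slack_gf (\<lambda>j. j mod N < M)) n"
    by (simp only: gf_nth slack_gf_def)
  show ?thesis using A unfolding B[symmetric] by (rule of_nat_eq_iff[THEN iffD1])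
qed

end
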